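(* Let $n\ge a+b$, and let $\mathcal{A}\subset\binom{[n]}{a}$ and $\mathcal{B}\subset\binom{[n]}{b}$ be cross-intersecting. Let $(U,V)$ satisfy property $\mathbf{Q}$ for the pair $(\mathcal{A},\mathcal{B})$. Then $S_{U,V}(\mathcal{A})$ and $S_{U,V}(\mathcal{B})$ are also cross-intersecting.
   Context: $[n]=\{1,\dots,n\}$; $\binom{[n]}{k}$ is the family of all $k$-subsets of $[n]$. Families $\mathcal{F},\mathcal{G}$ are cross-intersecting if $F\cap G\ne\emptyset$ for all $F\in\mathcal{F}$, $G\in\mathcal{G}$. Lexicographic order: for $A,B\subset[n]$ write $A\prec B$ if either $B\subset A$ or $\min(A\setminus B)<\min(B\setminus A)$. For a $k$-set $S\subset[n]$, $i_{\mathrm{lex}}(S)$ is the position of $S$ in the lexicographic order on $\binom{[n]}{k}$. Shift: for disjoint sets $U,V$ with $|U|=|V|$, put $S_{U,V}(F)=(F\setminus V)\cup U$ if $F\cap(U\cup V)=V$, and $S_{U,V}(F)=F$ otherwise; for a family, $S_{U,V}(\mathcal{F})=\{S_{U,V}(F):F\in\mathcal{F}\}\cup\{F\in\mathcal{F}:S_{U,V}(F)\in\mathcal{F}\}$. Property $\mathbf{Q}$: let $U,V\subset[n]$ with $U\cap V=\emptyset$, $|U|=|V|$ and $U\prec V$. The pair $(U,V)$ satisfies $\mathbf{Q}$ for a family $\mathcal{F}\subset\binom{[n]}{k}$ if $\sum_{S\in S_{U,V}(\mathcal{F})}i_{\mathrm{lex}}(S)<\sum_{S\in\mathcal{F}}i_{\mathrm{lex}}(S)$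 and for every $V'\subsetneq V$ there exists $U'\subsetneq U$ such that $U'\prec V'$, $|U'|=|V'|$ and $S_{U',V'}(\mathcal{F})=\mathcal{F}$. The pair $(U,V)$ satisfies $\mathbf{Q}$ for a pair of families $(\mathcal{A},\mathcal{B})$ if it satisfies $\mathbf{Q}$ for at least one of $\mathcal{A}$ and $\mathcal{B}$. *)

theory Defs
  imports "HOL-Library.Ramsey"
begin

definition cross_intersecting :: "'a set set \<Rightarrow> 'a set set \<Rightarrow> bool" where
  "cross_intersecting \<F> \<G> \<longleftrightarrow> (\<forall>F\<in>\<F>. \<forall>G\<in>\<G>. F \<inter> G \<noteq> {})"

(* The order is reflexive: property Q with V' = {} forces U' = {}, so {} must precede {}.
   The guard A - B \<noteq> {} reads the minimum of the empty set as infinity (Min {} is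
   unspecified); when B - A = {} the first disjunct already holds. *)
definition lex_prec :: "nat set \<Rightarrow> nat set \<Rightarrow> bool" (infix \<open>\<preceq>\<^sub>l\<^sub>e\<^sub>x\<close> 50) where
  "A \<preceq>\<^sub>l\<^sub>e\<^sub>x B \<longleftrightarrow> B \<subseteq> A \<or> (A - B \<noteq> {} \<and> Min (A - B) < Min (B - A))"

(* Positions are counted from 1, since a set precedes itself. *)
definition lex_pos :: "nat \<Rightarrow> nat \<Rightarrow> nat set \<Rightarrow> nat" where
  "lex_pos n k S = card {T \<in> nsets {1..n} k. T \<preceq>\<^sub>l\<^sub>e\<^sub>x S}"

definition shift_set :: "'a set \<Rightarrow> 'a set \<Rightarrow> 'a set \<Rightarrow> 'a set" where
  "shift_set U V F = (if F \<inter> (U \<union> V) = V then (F - V) \<union> U else F)"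

definition shift_family :: "'a set \<Rightarrow> 'a set \<Rightarrow> 'a set set \<Rightarrow> 'a set set" where
  "shift_family U V \<F> = shift_set U V ` \<F> \<union> {F \<in> \<F>. shift_set U V F \<in> \<F>}"

(* Meant for families contained in nsets {1..n} k. *)
definition property_Q :: "nat \<Rightarrow> nat \<Rightarrow> nat set \<Rightarrow> nat set \<Rightarrow> nat set set \<Rightarrow> bool" where
  "property_Q n k U V \<F> \<longleftrightarrow>
     U \<subseteq> {1..n} \<and> V \<subseteq> {1..n} \<and> U \<inter> V = {} \<and> card U = card V \<and> U \<preceq>\<^sub>l\<^sub>e\<^sub>x V \<and>
     (\<Sum>S\<in>shift_family U V \<F>. lex_pos n k S) < (\<Sum>S\<in>\<F>. lex_pos n k S) \<and>
     (\<forall>V'. V' \<subset> V \<longrightarrow>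
        (\<exists>U'. U' \<subset> U \<and> U' \<preceq>\<^sub>l\<^sub>e\<^sub>x V' \<and> card U' = card V' \<and> shift_family U' V' \<F> = \<F>))"

definition property_Q_pair ::
  "nat \<Rightarrow> nat \<Rightarrow> nat \<Rightarrow> nat set \<Rightarrow> nat set \<Rightarrow> nat set set \<Rightarrow> nat set set \<Rightarrow> bool" where
  "property_Q_pair n a b U V \<A> \<B> \<longleftrightarrow> property_Q n a U V \<A> \<or> property_Q n b U V \<B>"

end

theory Submission
  imports Defs
begin

text \<open>
  Suppose \<open>\<F>\<close> is fixed by the partial shifts and \<open>X\<close>, \<open>Y\<close> are disjoint members of the two
  shifted families. Exactly one of them, say the image of \<open>Z\<close>, is new, because two new sets share
  the nonempty set \<open>U\<close> and two old sets meet by hypothesis. The other one, an old set \<open>W\<close>, avoids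
  \<open>U\<close>. If \<open>V \<subseteq> W\<close>, then \<open>(W - V) \<union> U\<close> is old too and is disjoint from \<open>Z\<close>. Otherwise
  \<open>V' = V \<inter> W\<close> is a proper subset of \<open>V\<close>, and shifting whichever of \<open>Z\<close>, \<open>W\<close> lies in \<open>\<F>\<close> from
  \<open>V'\<close> to the corresponding \<open>U' \<subseteq> U\<close> yields a member of \<open>\<F>\<close> disjoint from the other one.
\<close>

lemma cross_intersecting_sym:
  "cross_intersecting \<F> \<G> \<Longrightarrow> cross_intersecting \<G> \<F>"
  by (auto simp: cross_intersecting_def Int_commute)

lemma shift_set_eq:
  assumes "U \<inter> V = {}"
  shows "shift_set U V F = (if V \<subseteq> F \<and> F \<inter> U = {} then F - V \<union> U else F)"
proof -
  have "F \<inter> (U \<union> V) = V \<longleftrightarrow> V \<subseteq> F \<and> F \<inter> U = {}"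
    using assms by auto
  then show ?thesis
    by (simp add: shift_set_def)
qed

text \<open>A movable member of \<open>\<F>\<close> that is kept owes its place to its image also
  lying in \<open>\<F>\<close>; this is the second fact of case \<open>old\<close>. The cases may
  overlap, since an image can already belong to \<open>\<F>\<close>.\<close>

lemma shift_family_cases:
  assumes "X \<in> shift_family U V \<F>" "U \<inter> V = {}"
  obtains (old) "X \<in> \<F>" "V \<subseteq> X \<Longrightarrow> X \<inter> U = {} \<Longrightarrow> X - V \<union> U \<in> \<F>"
    | (new) Z where "Z \<in> \<F>" "V \<subseteq> Z" "Z \<inter> U = {}" "X = Z - V \<union> U"
proof -
  consider Z where "Z \<in> \<F>" "X = shift_set U V Z" | "X \<in> \<F>" "shift_set U V X \<in> \<F>"
    using assms(1) unfolding shift_family_def by blast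
  then show ?thesis
  proof cases
    case (1 Z)
    show ?thesis
    proof (cases "V \<subseteq> Z \<and> Z \<inter> U = {}")
      case True
      with 1 show ?thesis
        using that(2)[of Z] by (simp add: shift_set_eq[OF assms(2)])
    next
      case False
      then have "X = Z"
        using 1 by (simp only: shift_set_eq[OF assms(2)] if_False)
      with 1 False show ?thesis
        by (intro that(1)) simp_all
    qed
  next
    case 2
    then show ?thesis
      by (intro that(1)) (simp_all add: shift_set_eq[OF assms(2)])
  qed
qed

lemma shift_family_fixed_mem:
  assumes "shift_family U V \<F> = \<F>" "X \<in> \<F>" "U \<inter> V = {}" "V \<subseteq> X" "X \<inter> U = {}"
  shows "X - V \<union> U \<in> \<F>"
proof -
  have "shift_set U V X \<in> shift_family U V \<F>"
    using assms(2) by (simp add: shift_family_def)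
  with assms show ?thesis
    by (simp add: shift_set_eq)
qed

text \<open>The partial shifts fix \<open>\<F>\<close> only, so the two mixed cases are not
  symmetric: in both, the set moved by a partial shift comes from \<open>\<F>\<close>.\<close>

lemma shift_family_cross_intersecting:
  assumes cross: "cross_intersecting \<F> \<G>"
    and "U \<inter> V = {}" and empty: "U = {} \<Longrightarrow> V = {}"
    and fixed: "\<And>V'. V' \<subset> V \<Longrightarrow> \<exists>U'\<subseteq>U. shift_family U' V' \<F> = \<F>"
  shows "cross_intersecting (shift_family U V \<F>) (shift_family U V \<G>)"
  unfolding cross_intersecting_def
proof (intro ballI notI)
  fix X Y
  assume X: "X \<in> shift_family U V \<F>" and Y: "Y \<in> shift_family U V \<G>" and disj: "X \<inter> Y = {}"
  have meet: "F \<inter> G \<noteq> {}" if "F \<in> \<F>" "G \<in> \<G>" for F G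
    using cross that by (auto simp: cross_intersecting_def)
  show False
    using X \<open>U \<inter> V = {}\<close>
  proof (cases rule: shift_family_cases)
    case old
    show False
      using Y \<open>U \<inter> V = {}\<close>
    proof (cases rule: shift_family_cases)
      case old
      show False using meet[OF \<open>X \<in> \<F>\<close> old(1)] disj by contradiction
    next
      case (new Z)
      have XU: "X \<inter> U = {}" using disj new(4) by blast
      show False
      proof (cases "V \<subseteq> X")
        case True
        then have "X - V \<union> U \<in> \<F>" using old(2) XU by blast
        moreover have "(X - V \<union> U) \<inter> Z = {}" using disj new(3,4) by blast
        ultimately show False using meet new(1) by metis
      next
        case False
        then have "V \<inter> X \<subset> V" by blast
        then obtain U' where U': "U' \<subseteq> U" "shift_family U' (V \<inter> X) \<F> = \<F>"
          using fixed by metis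
        have "X - (V \<inter> X) \<union> U' \<in> \<F>"
          using U'(2) \<open>X \<in> \<F>\<close>
          by (rule shift_family_fixed_mem) (use XU U'(1) in blast)+
        \<comment> \<open>As \<open>Y\<close> contains \<open>Z - V\<close>, the sets
          \<open>X\<close> and \<open>Z\<close> meet only inside \<open>V\<close>, and that part of
          \<open>X\<close> is removed; the added \<open>U'\<close> lies in \<open>U\<close>, which
          misses \<open>Z\<close>.\<close>
        moreover have "(X - (V \<inter> X) \<union> U') \<inter> Z = {}"
          using disj new(2-4) U'(1) by blast
        ultimately show False using meet new(1) by metis
      qed
    qed
  next
    case (new Z)
    show False
      using Y \<open>U \<inter> V = {}\<close>
    proof (cases rule: shift_family_cases)
      case old
      have YU: "Y \<inter> U = {}" using disj new(4) by blast
      show False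
      proof (cases "V \<subseteq> Y")
        case True
        \<comment> \<open>The survival of \<open>Y\<close> supplies this image in
          \<open>\<G>\<close>.\<close>
        then have "Y - V \<union> U \<in> \<G>" using old(2) YU by blast
        moreover have "Z \<inter> (Y - V \<union> U) = {}" using disj new(3,4) by blast
        ultimately show False using meet new(1) by metis
      next
        case False
        then have "V \<inter> Y \<subset> V" by blast
        then obtain U' where U': "U' \<subseteq> U" "shift_family U' (V \<inter> Y) \<F> = \<F>"
          using fixed by metis
        have "Z - (V \<inter> Y) \<union> U' \<in> \<F>"
          using U'(2) \<open>Z \<in> \<F>\<close>
          by (rule shift_family_fixed_mem) (use new(2,3) YU U'(1) in blast)+
        \<comment> \<open>Here \<open>Z\<close> is moved instead: it meets \<open>Y\<close> only
          inside \<open>V\<close>, and \<open>U'\<close> misses \<open>Y\<close> because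
          \<open>U\<close> does.\<close>
        moreover have "(Z - (V \<inter> Y) \<union> U') \<inter> Y = {}"
          using disj new(4) YU U'(1) by blast
        ultimately show False using meet old(1) by metis
      qed
    next
      case (new Z')
      \<comment> \<open>Both sets contain \<open>U\<close>, so disjointness leaves only the
        degenerate shift, which is the identity.\<close>
      have "U = {}" using disj \<open>X = Z - V \<union> U\<close> new(4) by blast
      then have "X = Z" "Y = Z'" using empty \<open>X = Z - V \<union> U\<close> new(4) by simp_all
      with disj meet[OF \<open>Z \<in> \<F>\<close> new(1)] show False by simp
    qed
  qed
qed

lemma property_Q_cross_intersecting:
  assumes "property_Q n k U V \<F>" "cross_intersecting \<F> \<G>"
  shows "cross_intersecting (shift_family U V \<F>) (shift_family U V \<G>)"
proof (rule shift_family_cross_intersecting[OF assms(2)])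
  \<comment> \<open>\<open>card\<close> is 0 on infinite sets, so \<open>card V = 0\<close> yields
    \<open>V = {}\<close> only for finite \<open>V\<close>.\<close>
  have "finite V"
    using assms(1) finite_subset[of V "{1..n}"] by (simp add: property_Q_def)
  then show "V = {}" if "U = {}"
    using assms(1) that by (simp add: property_Q_def)
  show "U \<inter> V = {}"
    using assms(1) by (simp add: property_Q_def)
  show "\<exists>U'\<subseteq>U. shift_family U' V' \<F> = \<F>" if "V' \<subset> V" for V'
    using assms(1) that unfolding property_Q_def by (meson psubset_imp_subset)
qed

theorem lemma9p1:
  fixes n a b :: nat and \<A> \<B> :: "nat set set" and U V :: "nat set"
  assumes "n \<ge> a + b"
    and "\<A> \<subseteq> nsets {1..n} a"
    and "\<B> \<subseteq> nsets {1..n} b"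
    and "cross_intersecting \<A> \<B>"
    and "property_Q_pair n a b U V \<A> \<B>"
  shows "cross_intersecting (shift_family U V \<A>) (shift_family U V \<B>)"
  using assms(5) unfolding property_Q_pair_def
proof
  assume "property_Q n a U V \<A>"
  then show ?thesis
    using assms(4) by (rule property_Q_cross_intersecting)
next
  assume "property_Q n b U V \<B>"
  moreover have "cross_intersecting \<B> \<A>"
    using assms(4) by (rule cross_intersecting_sym)
  ultimately show ?thesis
    by (rule cross_intersecting_sym[OF property_Q_cross_intersecting])
qed

end
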